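(* Let $\beta\in(0,1]$ and $n\in\mathbb{N}$. If the function $f$ is $(n+1)$ times $\beta$-fractional differentiable on $[0,\infty)$ and $s,t\in[0,\infty)$, then $$f(t)=\sum_{k=0}^{n}\frac{\beta^{-k}}{k!}\left[\left(t+\frac{1}{\Gamma(\beta)}\right)^{\beta}-\left(s+\frac{1}{\Gamma(\beta)}\right)^{\beta}\right]^{k}D^{k\beta}f(s)+\frac{\beta^{-n}}{n!}\int_{s}^{t}\left[\left(t+\frac{1}{\Gamma(\beta)}\right)^{\beta}-\left(\tau+\frac{1}{\Gamma(\beta)}\right)^{\beta}\right]^{n}D^{(n+1)\beta}f(\tau)\,d_\beta\tau .$$
   Context: $\Gamma$ is the Gamma function and $\mathbb{N}$ is the set of natural numbers; $f$ is a real-valued function on $[0,\infty)$. For $\beta\in(0,1]$, the $\beta$-derivative of $f$ at $x\ge 0$ is $D^{\beta}f(x)=\lim_{\varepsilon\to0}\frac{f\left(x+\varepsilon\left(x+\frac{1}{\Gamma(\beta)}\right)^{1-\beta}\right)-f(x)}{\varepsilon}$, where $\varepsilon$ ranges over values for which the argument lies in the domain of $f$; if the limit exists, $f$ is said to be $\beta$-fractional differentiable at $x$. $D^{k\beta}f$ denotes the $k$-fold iterate of $D^{\beta}$ applied to $f$, with $D^{0}f=f$, and $f$ is $k$ times $\beta$-fractional differentiable if $D^{\beta}f,\dots,D^{k\beta}f$ all exist on the domain. The $\beta$-integral is $\int_a^b h(t)\,d_\beta t:=\int_a^b\left(t+\frac{1}{\Gamma(\beta)}\right)^{\beta-1}h(t)\,dt$,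 with $\int_s^t=-\int_t^s$ when $s>t$. The $k=0$ term of the sum is $f(s)$. *)

theory Defs
  imports "HOL-Analysis.Analysis"
begin

text \<open>
  A function on the half-line \<open>[0, \<infinity>)\<close> is represented by a total function
  \<open>real \<Rightarrow> real\<close>. Only its values on \<open>[0, \<infinity>)\<close> enter below: the increment is restricted to
  those \<open>\<epsilon>\<close> for which the shifted argument is nonnegative (so the limit is one-sided at
  \<open>x = 0\<close>).
\<close>

definition has_beta_derivative :: "real \<Rightarrow> (real \<Rightarrow> real) \<Rightarrow> real \<Rightarrow> real \<Rightarrow> bool" where
  "has_beta_derivative \<beta> f d x \<longleftrightarrow>
     ((\<lambda>\<epsilon>. (f (x + \<epsilon> * (x + 1 / Gamma \<beta>) powr (1 - \<beta>)) - f x) / \<epsilon>) \<longlongrightarrow> d)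
       (at 0 within {\<epsilon>. 0 \<le> x + \<epsilon> * (x + 1 / Gamma \<beta>) powr (1 - \<beta>)})"

definition beta_differentiable :: "real \<Rightarrow> (real \<Rightarrow> real) \<Rightarrow> real \<Rightarrow> bool" where
  "beta_differentiable \<beta> f x \<longleftrightarrow> (\<exists>d. has_beta_derivative \<beta> f d x)"

text \<open>The value is meaningful only where the limit exists and \<open>x \<ge> 0\<close>.\<close>

definition beta_deriv :: "real \<Rightarrow> (real \<Rightarrow> real) \<Rightarrow> real \<Rightarrow> real" where
  "beta_deriv \<beta> f x = (THE d. has_beta_derivative \<beta> f d x)"

definition beta_deriv_iter :: "real \<Rightarrow> nat \<Rightarrow> (real \<Rightarrow> real) \<Rightarrow> real \<Rightarrow> real" where
  "beta_deriv_iter \<beta> k f = (beta_deriv \<beta> ^^ k) f"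

definition times_beta_differentiable :: "nat \<Rightarrow> real \<Rightarrow> (real \<Rightarrow> real) \<Rightarrow> bool" where
  "times_beta_differentiable m \<beta> f \<longleftrightarrow>
     (\<forall>k<m. \<forall>x\<ge>0. beta_differentiable \<beta> (beta_deriv_iter \<beta> k f) x)"

text \<open>
  The integral is the Henstock--Kurzweil integral: a derivative that exists everywhere need not
  be Riemann or Lebesgue integrable, but it is always Henstock--Kurzweil integrable.
\<close>

definition beta_integrable :: "real \<Rightarrow> (real \<Rightarrow> real) \<Rightarrow> real \<Rightarrow> real \<Rightarrow> bool" where
  "beta_integrable \<beta> h a b \<longleftrightarrow>
     (\<lambda>t. (t + 1 / Gamma \<beta>) powr (\<beta> - 1) * h t) integrable_on {min a b..max a b}"

definition beta_integral :: "real \<Rightarrow> (real \<Rightarrow> real) \<Rightarrow> real \<Rightarrow> real \<Rightarrow> real" where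
  "beta_integral \<beta> h a b =
     (if a \<le> b then integral {a..b} (\<lambda>t. (t + 1 / Gamma \<beta>) powr (\<beta> - 1) * h t)
      else - integral {b..a} (\<lambda>t. (t + 1 / Gamma \<beta>) powr (\<beta> - 1) * h t))"

end

theory Submission
  imports Defs
begin

text \<open>
  With \<open>c = 1 / \<Gamma>(\<beta>) > 0\<close>, the \<open>\<beta>\<close>-derivative of \<open>f\<close> at \<open>x\<close> is \<open>(x + c) powr (1 - \<beta>)\<close> times the
  ordinary derivative within \<open>[0, \<infinity>)\<close>. Put \<open>\<phi> x = (x + c) powr \<beta>\<close>, so that
  \<open>\<phi>' x = \<beta> * (x + c) powr (\<beta> - 1)\<close>. Differentiating
  \<open>(\<Sum>k\<le>n. inverse (\<beta> ^ k) / fact k * (\<phi> t - \<phi> x) ^ k * D\<^sup>k f x)\<close> with respect to \<open>x\<close> telescopes to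
  the integrand of the remainder, and the sum equals \<open>f t\<close> at \<open>x = t\<close>. The fundamental theorem of
  calculus for the Henstock--Kurzweil integral then gives both the integrability and the formula.
\<close>

text \<open>Substitute \<open>\<epsilon> = (y - x) / w\<close>, where
  \<open>w = (x + 1 / Gamma \<beta>) powr (1 - \<beta>)\<close> is positive: the shifted argument
  becomes \<open>y\<close>, so the constraint on \<open>\<epsilon>\<close> turns into
  \<open>0 \<le> y\<close>.\<close>

lemma has_beta_derivative_imp_has_real_derivative:
  fixes \<beta> x d :: real
  assumes "0 < \<beta>" "0 \<le> x" and d: "has_beta_derivative \<beta> f d x"
  shows "(f has_real_derivative (x + 1 / Gamma \<beta>) powr (\<beta> - 1) * d) (at x within {0..})"
proof -
  define w where "w = (x + 1 / Gamma \<beta>) powr (1 - \<beta>)"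
  have "x + 1 / Gamma \<beta> > 0"
    using assms Gamma_real_pos[of \<beta>] by (simp add: add_nonneg_pos)
  then have w: "w > 0" and inv_w: "(x + 1 / Gamma \<beta>) powr (\<beta> - 1) = inverse w"
    unfolding w_def by (simp_all flip: powr_minus)
  have "((\<lambda>y. (y - x) / w) \<longlongrightarrow> (x - x) / w) (at x within {0..})"
    using w by (intro tendsto_intros) auto
  then have "filterlim (\<lambda>y. (y - x) / w) (at 0 within {\<epsilon>. 0 \<le> x + \<epsilon> * w}) (at x within {0..})"
    using w by (auto simp: filterlim_at eventually_at_filter)
  moreover have "((\<lambda>\<epsilon>. (f (x + \<epsilon> * w) - f x) / \<epsilon>) \<longlongrightarrow> d) (at 0 within {\<epsilon>. 0 \<le> x + \<epsilon> * w})"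
    using d unfolding has_beta_derivative_def w_def .
  ultimately have "((\<lambda>y. (f (x + (y - x) / w * w) - f x) / ((y - x) / w)) \<longlongrightarrow> d)
      (at x within {0..})"
    by (rule filterlim_compose[rotated])
  then have "((\<lambda>y. inverse w * ((f (x + (y - x) / w * w) - f x) / ((y - x) / w)))
      \<longlongrightarrow> inverse w * d) (at x within {0..})"
    by (rule tendsto_mult_left)
  \<comment> \<open>Valid for every \<open>y\<close>: at \<open>y = x\<close> both sides are 0,
    since division by zero gives 0.\<close>
  moreover have "inverse w * ((f (x + (y - x) / w * w) - f x) / ((y - x) / w)) = (f y - f x) / (y - x)"
    for y
    using w by simp
  ultimately show ?thesis
    unfolding has_field_derivative_iff inv_w by (simp only:)
qed

text \<open>The definite description in \<open>beta_deriv\<close> denotes the limit because ordinary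
  derivatives within the half-line are unique.\<close>

lemma has_real_derivative_beta_deriv:
  fixes \<beta> x :: real
  assumes "0 < \<beta>" "0 \<le> x" "beta_differentiable \<beta> f x"
  shows "(f has_real_derivative (x + 1 / Gamma \<beta>) powr (\<beta> - 1) * beta_deriv \<beta> f x)
           (at x within {0..})"
proof -
  have pos: "x + 1 / Gamma \<beta> > 0"
    using assms Gamma_real_pos[of \<beta>] by (simp add: add_nonneg_pos)
  \<comment> \<open>A connected set with more than one point has no isolated points; this covers the
    endpoint \<open>x = 0\<close>.\<close>
  have "x islimpt {0..}"
  proof (rule connected_imp_perfect)
    show "{0..} \<noteq> {y}" for y :: real
      by (metis infinite_Ici finite.emptyI finite.insertI)
  qed (use assms in auto)
  then have "at x within {0..} \<noteq> bot"
    by (simp add: trivial_limit_within)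
  then have unique: "d = d'" if "has_beta_derivative \<beta> f d x" "has_beta_derivative \<beta> f d' x" for d d'
    using tendsto_unique that[THEN has_beta_derivative_imp_has_real_derivative[OF assms(1,2)]] pos
    unfolding has_field_derivative_iff by fastforce
  obtain d where d: "has_beta_derivative \<beta> f d x"
    using assms by (auto simp: beta_differentiable_def)
  then have "beta_deriv \<beta> f x = d"
    unfolding beta_deriv_def using unique by blast
  then show ?thesis
    using has_beta_derivative_imp_has_real_derivative[OF assms(1,2) d] by simp
qed

text \<open>The telescoping depends only on how \<open>\<phi>\<close> and the \<open>g k\<close>
  differentiate, so \<open>powr\<close> and \<open>Gamma\<close> stay out of the induction.\<close>

lemma weighted_taylor_sum_has_real_derivative:
  fixes \<phi> w :: "real \<Rightarrow> real" and g :: "nat \<Rightarrow> real \<Rightarrow> real" and \<beta> C x :: real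
  assumes "\<beta> \<noteq> 0"
    and [derivative_intros]: "(\<phi> has_real_derivative \<beta> * w x) (at x within S)"
    and "\<And>k. k \<le> n \<Longrightarrow> (g k has_real_derivative w x * g (Suc k) x) (at x within S)"
  shows "((\<lambda>y. \<Sum>k=0..n. inverse (\<beta> ^ k) / fact k * (C - \<phi> y) ^ k * g k y) has_real_derivative
           inverse (\<beta> ^ n) / fact n * (w x * ((C - \<phi> x) ^ n * g (Suc n) x))) (at x within S)"
  using assms(3)
proof (induction n)
  case 0
  then show ?case
    by simp
next
  case (Suc n)
  let ?c = "inverse (\<beta> ^ Suc n) / fact (Suc n) :: real"
  note [derivative_intros] = Suc.prems[OF le_refl]
  \<comment> \<open>Product rule for the new top term: the part from differentiating the power
    cancels the derivative given by the induction hypothesis.\<close>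
  have "((\<lambda>y. ?c * (C - \<phi> y) ^ Suc n * g (Suc n) y) has_real_derivative
      ?c * (w x * ((C - \<phi> x) ^ Suc n * g (Suc (Suc n)) x))
      - (?c * (real (Suc n) * \<beta>)) * (w x * ((C - \<phi> x) ^ n * g (Suc n) x))) (at x within S)"
    by (rule derivative_eq_intros refl | simp add: algebra_simps del: of_nat_Suc fact_Suc)+
  moreover have "?c * (real (Suc n) * \<beta>) = inverse (\<beta> ^ n) / fact n"
    using \<open>\<beta> \<noteq> 0\<close> by (simp add: field_simps del: of_nat_Suc)
  ultimately have "((\<lambda>y. ?c * (C - \<phi> y) ^ Suc n * g (Suc n) y) has_real_derivative
      ?c * (w x * ((C - \<phi> x) ^ Suc n * g (Suc (Suc n)) x))
      - inverse (\<beta> ^ n) / fact n * (w x * ((C - \<phi> x) ^ n * g (Suc n) x))) (at x within S)"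
    by (simp only:)
  from DERIV_add[OF Suc.IH[OF Suc.prems] this] show ?case
    by (simp del: fact_Suc power_Suc)
qed

theorem theorem1:
  fixes \<beta> s t :: real and n :: nat and f :: "real \<Rightarrow> real"
  assumes "0 < \<beta>" and "\<beta> \<le> 1"
    and "times_beta_differentiable (n + 1) \<beta> f"
    and "0 \<le> s" and "0 \<le> t"
  shows "beta_integrable \<beta>
           (\<lambda>\<tau>. ((t + 1 / Gamma \<beta>) powr \<beta> - (\<tau> + 1 / Gamma \<beta>) powr \<beta>) ^ n
                  * beta_deriv_iter \<beta> (n + 1) f \<tau>) s t
       \<and> f t =
           (\<Sum>k=0..n. \<beta> powi (- int k) / fact k
               * ((t + 1 / Gamma \<beta>) powr \<beta> - (s + 1 / Gamma \<beta>) powr \<beta>) ^ k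
               * beta_deriv_iter \<beta> k f s)
           + \<beta> powi (- int n) / fact n
               * beta_integral \<beta>
                   (\<lambda>\<tau>. ((t + 1 / Gamma \<beta>) powr \<beta> - (\<tau> + 1 / Gamma \<beta>) powr \<beta>) ^ n
                          * beta_deriv_iter \<beta> (n + 1) f \<tau>) s t"
proof -
  let ?g = "\<lambda>k. beta_deriv_iter \<beta> k f"
  let ?w = "\<lambda>x. (x + 1 / Gamma \<beta>) powr (\<beta> - 1)"
  let ?\<phi> = "\<lambda>x. (x + 1 / Gamma \<beta>) powr \<beta>"
  let ?h = "\<lambda>x. ?w x * ((?\<phi> t - ?\<phi> x) ^ n * ?g (n + 1) x)"
  define c where "c = inverse (\<beta> ^ n) / fact n"
  define F where "F x = (\<Sum>k=0..n. inverse (\<beta> ^ k) / fact k * (?\<phi> t - ?\<phi> x) ^ k * ?g k x)" for x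
  have "c \<noteq> 0"
    using \<open>0 < \<beta>\<close> by (simp add: c_def)
  have F_deriv: "(F has_real_derivative c * ?h x) (at x within {0..})" if "0 \<le> x" for x
  proof -
    have "x + 1 / Gamma \<beta> > 0"
      using that \<open>0 < \<beta>\<close> Gamma_real_pos[of \<beta>] by (simp add: add_nonneg_pos)
    then have "(?\<phi> has_real_derivative \<beta> * ?w x) (at x within {0..})"
      by (auto intro!: derivative_eq_intros)
    moreover have "(?g k has_real_derivative ?w x * ?g (Suc k) x) (at x within {0..})"
      if "k \<le> n" for k
      using has_real_derivative_beta_deriv[OF \<open>0 < \<beta>\<close> \<open>0 \<le> x\<close>, of "?g k"] that \<open>0 \<le> x\<close> assms(3)
      by (simp add: times_beta_differentiable_def beta_deriv_iter_def)
    ultimately show ?thesis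
      using weighted_taylor_sum_has_real_derivative[of \<beta> ?\<phi> ?w x "{0..}" n ?g "?\<phi> t"] \<open>0 < \<beta>\<close>
      unfolding F_def[abs_def] c_def by simp
  qed
  \<comment> \<open>Stated for arbitrary endpoints so that it serves both \<open>s \<le> t\<close>
    and \<open>t \<le> s\<close>.\<close>
  have h: "(?h has_integral (F b - F a) / c) {a..b}" if "0 \<le> a" "a \<le> b" for a b
  proof -
    have "((\<lambda>x. c * ?h x) has_integral F b - F a) {a..b}"
    proof (rule fundamental_theorem_of_calculus)
      fix x assume "x \<in> {a..b}"
      then show "(F has_vector_derivative c * ?h x) (at x within {a..b})"
        using F_deriv[of x] that
        by (auto simp flip: has_real_derivative_iff_has_vector_derivative
            intro: has_field_derivative_subset)
    qed (use that in auto)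
    from has_integral_divide[OF this, of c] show ?thesis
      using \<open>c \<noteq> 0\<close> by simp
  qed
  \<comment> \<open>All terms with \<open>k > 0\<close> contain a positive power of 0; the term
    \<open>k = 0\<close> is \<open>f t\<close>, as \<open>0 ^ 0 = 1\<close>.\<close>
  have "F t = f t"
    unfolding F_def by (subst sum.atLeast_Suc_atMost) (auto simp: beta_deriv_iter_def intro: sum.neutral)
  moreover have "F s = (\<Sum>k=0..n. \<beta> powi (- int k) / fact k * (?\<phi> t - ?\<phi> s) ^ k * ?g k s)"
    unfolding F_def by (simp add: power_int_minus)
  moreover have "\<beta> powi (- int n) / fact n = c"
    unfolding c_def by (simp add: power_int_minus)
  \<comment> \<open>For \<open>t < s\<close> the minus sign in \<open>beta_integral\<close> turns
    \<open>(F s - F t) / c\<close> into the same value.\<close>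
  moreover have "beta_integral \<beta> (\<lambda>\<tau>. (?\<phi> t - ?\<phi> \<tau>) ^ n * ?g (n + 1) \<tau>) s t = (F t - F s) / c"
    using h[THEN integral_unique, of s t] h[THEN integral_unique, of t s] assms(4,5)
    by (auto simp: beta_integral_def minus_divide_left)
  moreover have "beta_integrable \<beta> (\<lambda>\<tau>. (?\<phi> t - ?\<phi> \<tau>) ^ n * ?g (n + 1) \<tau>) s t"
    using h[THEN has_integral_integrable, of "min s t" "max s t"] assms(4,5)
    by (simp add: beta_integrable_def)
  ultimately show ?thesis
    using \<open>c \<noteq> 0\<close> by simp
qed

end
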